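(* Let $n\ge 2$, let $m\ge 1$ be an integer, and let $H_1,H_2\in B_n$ be half-twists with $H_1^m=H_2^m$. Then $H_1=H_2$.
   Context: $B_n$ is Artin's braid group with generators $\sigma_1,\dots,\sigma_{n-1}$ and relations $\sigma_i\sigma_j=\sigma_j\sigma_i$ for $|i-j|\ge 2$ and $\sigma_i\sigma_{i+1}\sigma_i=\sigma_{i+1}\sigma_i\sigma_{i+1}$. A half-twist is an element of the conjugacy class of $\sigma_1$ in $B_n$, i.e. an element $q^{-1}\sigma_1 q$ with $q\in B_n$. *)

theory Defs
  imports "HOL-Algebra.Group"
begin

text \<open>Artin braid group B_n by generators and relations.
  A letter (i, True) stands for sigma_i, (i, False) for its inverse; admissible
  indices are 1 <= i <= n-1.  B_n is the set of words modulo the congruence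
  generated by free cancellation and the braid relations.\<close>

type_synonym bword = "(nat \<times> bool) list"

definition braid_wf :: "nat \<Rightarrow> bword \<Rightarrow> bool" where
  "braid_wf n w \<longleftrightarrow> (\<forall>(i,b)\<in>set w. 1 \<le> i \<and> i < n)"

inductive braid_eq :: "nat \<Rightarrow> bword \<Rightarrow> bword \<Rightarrow> bool" for n :: nat where
  refl: "braid_eq n w w"
| sym: "braid_eq n x y \<Longrightarrow> braid_eq n y x"
| trans: "braid_eq n x y \<Longrightarrow> braid_eq n y z \<Longrightarrow> braid_eq n x z"
| cong: "braid_eq n x y \<Longrightarrow> braid_eq n (u @ x @ v) (u @ y @ v)"
| cancel: "1 \<le> i \<Longrightarrow> i < n \<Longrightarrow> braid_eq n [(i, b), (i, \<not> b)] []"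
| far_comm: "1 \<le> i \<Longrightarrow> i + 2 \<le> j \<Longrightarrow> j < n \<Longrightarrow>
     braid_eq n [(i, True), (j, True)] [(j, True), (i, True)]"
| braid: "1 \<le> i \<Longrightarrow> i + 1 < n \<Longrightarrow>
     braid_eq n [(i, True), (i+1, True), (i, True)] [(i+1, True), (i, True), (i+1, True)]"

definition braid_class :: "nat \<Rightarrow> bword \<Rightarrow> bword set" where
  "braid_class n w = {v. braid_wf n v \<and> braid_eq n w v}"

definition braid_mult :: "nat \<Rightarrow> bword set \<Rightarrow> bword set \<Rightarrow> bword set" where
  "braid_mult n A B = (\<Union>a\<in>A. \<Union>b\<in>B. braid_class n (a @ b))"

definition braid_group :: "nat \<Rightarrow> bword set monoid" where
  "braid_group n = \<lparr> carrier = braid_class n ` {w. braid_wf n w},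
                     mult = braid_mult n,
                     one = braid_class n [] \<rparr>"

definition braid_sigma :: "nat \<Rightarrow> nat \<Rightarrow> bword set" where
  "braid_sigma n i = braid_class n [(i, True)]"

definition half_twist :: "nat \<Rightarrow> bword set \<Rightarrow> bool" where
  "half_twist n h \<longleftrightarrow> (\<exists>q\<in>carrier (braid_group n).
      h = inv\<^bsub>braid_group n\<^esub> q \<otimes>\<^bsub>braid_group n\<^esub> braid_sigma n 1 \<otimes>\<^bsub>braid_group n\<^esub> q)"

end

theory Submission
  imports Defs
begin

text \<open>The claim says that a braid commuting with \<open>\<sigma>\<^sub>1\<^sup>m\<close> commutes with \<open>\<sigma>\<^sub>1\<close>. Multiplying by a power
  of the central full twist \<open>(\<sigma>\<^sub>1 \<dots> \<sigma>\<^bsub>n-1\<^esub>)\<^sup>n\<close> makes the braid positive, and the positive monoid embeds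
  into the group because it is left cancellative (Garside). It remains to see that
  \<open>u s\<^sup>m = t\<^sup>m u\<close> implies \<open>u s = t u\<close> for a positive braid \<open>u\<close> and generators \<open>s\<close>, \<open>t\<close>, by induction on the
  length of \<open>u\<close>. If the first letter \<open>r\<close> of \<open>u\<close> commutes with \<open>t\<close>, cancel it. Otherwise the right lcm
  of \<open>r\<close> and \<open>t\<^sup>m\<close> is \<open>t\<^sup>m r t = r t r\<^sup>m\<close>, which forces \<open>u = r t v\<close> with \<open>v s\<^sup>m = r\<^sup>m v\<close>; by induction
  \<open>v s = r v\<close>, and then \<open>u s = r t r v = t r t v = t u\<close>.\<close>

section \<open>The positive braid monoid\<close>

definition adjacent :: "nat \<Rightarrow> nat \<Rightarrow> bool" where
  "adjacent i j \<longleftrightarrow> j = Suc i \<or> i = Suc j"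

definition distant :: "nat \<Rightarrow> nat \<Rightarrow> bool" where
  "distant i j \<longleftrightarrow> i + 2 \<le> j \<or> j + 2 \<le> i"

lemma adjacent_sym: "adjacent i j \<longleftrightarrow> adjacent j i"
  by (auto simp: adjacent_def)

lemma distant_sym: "distant i j \<longleftrightarrow> distant j i"
  by (auto simp: distant_def)

lemma index_pair_cases [case_names equal adjacent distant]:
  obtains "i = j" | "adjacent i j" | "distant i j"
  unfolding adjacent_def distant_def by linarith

inductive pos_step :: "nat list \<Rightarrow> nat list \<Rightarrow> bool" where
  distant: "distant i j \<Longrightarrow> pos_step (i # j # w) (j # i # w)"
| adjacent: "adjacent i j \<Longrightarrow> pos_step (i # j # i # w) (j # i # j # w)"
| Cons: "pos_step x y \<Longrightarrow> pos_step (a # x) (a # y)"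

abbreviation pos_eq :: "nat list \<Rightarrow> nat list \<Rightarrow> bool" where
  "pos_eq \<equiv> pos_step\<^sup>*\<^sup>*"

lemma pos_step_sym: "pos_step x y \<Longrightarrow> pos_step y x"
  by (induction rule: pos_step.induct) (auto intro: pos_step.intros simp: adjacent_sym distant_sym)

lemma pos_eq_sym: "pos_eq x y \<Longrightarrow> pos_eq y x"
  using sympD[OF symp_rtranclp[OF sympI[of pos_step, OF pos_step_sym]]] .

lemma pos_step_append_right: "pos_step x y \<Longrightarrow> pos_step (x @ w) (y @ w)"
  by (induction rule: pos_step.induct) (auto intro: pos_step.intros)

lemma pos_step_append_left: "pos_step x y \<Longrightarrow> pos_step (w @ x) (w @ y)"
  by (induction w) (auto intro: pos_step.intros)

lemma pos_eq_append:
  assumes "pos_eq x x'" and "pos_eq y y'"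
  shows "pos_eq (x @ y) (x' @ y')"
proof -
  have "pos_eq (x @ y) (x' @ y)"
    using assms(1)
    by (induction rule: rtranclp_induct) (auto intro: pos_step_append_right rtranclp.rtrancl_into_rtrancl)
  moreover have "pos_eq (x' @ y) (x' @ y')"
    using assms(2)
    by (induction rule: rtranclp_induct) (auto intro: pos_step_append_left rtranclp.rtrancl_into_rtrancl)
  ultimately show ?thesis by simp
qed

lemma pos_step_length_set: "pos_step x y \<Longrightarrow> length x = length y \<and> set x = set y"
  by (induction rule: pos_step.induct) auto

lemma pos_eq_length: "pos_eq x y \<Longrightarrow> length x = length y"
  by (induction rule: rtranclp_induct) (auto dest: pos_step_length_set)

lemma pos_eq_set: "pos_eq x y \<Longrightarrow> set x = set y"
  by (induction rule: rtranclp_induct) (auto dest: pos_step_length_set)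

quotient_type pbraid = "nat list" / pos_eq
  by (intro equivpI reflpI sympI transpI) (auto intro: pos_eq_sym)

instantiation pbraid :: monoid_mult
begin

lift_definition one_pbraid :: pbraid is "[]" .
lift_definition times_pbraid :: "pbraid \<Rightarrow> pbraid \<Rightarrow> pbraid" is append
  by (rule pos_eq_append)

instance by standard (transfer; simp)+

end

lift_definition of_word :: "nat list \<Rightarrow> pbraid" is "\<lambda>w. w" .
lift_definition gen :: "nat \<Rightarrow> pbraid" is "\<lambda>i. [i]" .
lift_definition plength :: "pbraid \<Rightarrow> nat" is length by (rule pos_eq_length)
lift_definition letters :: "pbraid \<Rightarrow> nat set" is set by (rule pos_eq_set)

lemma of_word_Nil [simp]: "of_word [] = 1"
  by transfer simp

lemma of_word_Cons: "of_word (a # w) = gen a * of_word w"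
  by transfer simp

lemma of_word_append: "of_word (v @ w) = of_word v * of_word w"
  by transfer simp

lemma of_word_eq_iff: "of_word v = of_word w \<longleftrightarrow> pos_eq v w"
  by transfer simp

lemma of_word_rep_pbraid [simp]: "of_word (rep_pbraid X) = X"
  by (metis Quotient3_abs_rep Quotient3_pbraid of_word.abs_eq)

lemma letters_of_word [simp]: "letters (of_word w) = set w"
  by transfer simp

lemma letters_one [simp]: "letters 1 = {}"
  by transfer simp

lemma letters_gen [simp]: "letters (gen i) = {i}"
  by transfer simp

lemma letters_mult [simp]: "letters (X * Y) = letters X \<union> letters Y"
  by transfer simp

lemma letters_power: "letters (X ^ k) = (if k = 0 then {} else letters X)"
  by (induction k) auto

lemma plength_of_word [simp]: "plength (of_word w) = length w"
  by transfer simp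

lemma plength_gen [simp]: "plength (gen i) = 1"
  by transfer simp

lemma plength_mult [simp]: "plength (X * Y) = plength X + plength Y"
  by transfer simp

lemma pbraid_cases [case_names one gen_mult]:
  obtains "X = 1" | a Y where "X = gen a * Y"
  by (metis neq_Nil_conv of_word_Cons of_word_Nil of_word_rep_pbraid)

lemma pbraid_induct [case_names one gen_mult]:
  assumes "P 1" and "\<And>a Y. P Y \<Longrightarrow> P (gen a * Y)"
  shows "P X"
proof -
  have "P (of_word w)" for w
    using assms by (induction w) (simp_all add: of_word_Cons)
  from this[of "rep_pbraid X"] show ?thesis by simp
qed

lemma gen_distant: "distant i j \<Longrightarrow> gen i * gen j = gen j * gen i"
  by transfer (auto intro: pos_step.distant)

lemma gen_adjacent: "adjacent i j \<Longrightarrow> gen i * gen j * gen i = gen j * gen i * gen j"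
  by transfer (auto intro: pos_step.adjacent)

lemma gen_distant_left: "distant i j \<Longrightarrow> gen i * (gen j * X) = gen j * (gen i * X)"
  using gen_distant[of i j] by (simp flip: mult.assoc)

lemma gen_adjacent_left:
  "adjacent i j \<Longrightarrow> gen i * (gen j * (gen i * X)) = gen j * (gen i * (gen j * X))"
  using gen_adjacent[of i j] by (simp flip: mult.assoc)

section \<open>Least common multiples of generators\<close>

text \<open>\<open>gen a * right_complement a b\<close> is the right lcm of \<open>gen a\<close> and \<open>gen b\<close>.\<close>

definition right_complement :: "nat \<Rightarrow> nat \<Rightarrow> pbraid" where
  "right_complement a b =
     (if a = b then 1 else if adjacent a b then gen b * gen a else gen b)"

definition through_lcm :: "nat \<Rightarrow> pbraid \<Rightarrow> nat \<Rightarrow> pbraid \<Rightarrow> bool" where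
  "through_lcm a X b Y \<longleftrightarrow>
     (\<exists>Z. X = right_complement a b * Z \<and> Y = right_complement b a * Z)"

lemma through_lcm_sym: "through_lcm a X b Y \<longleftrightarrow> through_lcm b Y a X"
  unfolding through_lcm_def by blast

lemma through_lcm_self [simp]: "through_lcm a X a Y \<longleftrightarrow> X = Y"
  by (auto simp: through_lcm_def right_complement_def)

lemma through_lcm_adjacent:
  "adjacent a b \<Longrightarrow>
     through_lcm a X b Y \<longleftrightarrow> (\<exists>Z. X = gen b * (gen a * Z) \<and> Y = gen a * (gen b * Z))"
  by (auto simp: through_lcm_def right_complement_def adjacent_def mult.assoc)

lemma through_lcm_distant:
  "distant a b \<Longrightarrow> through_lcm a X b Y \<longleftrightarrow> (\<exists>Z. X = gen b * Z \<and> Y = gen a * Z)"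
  by (auto simp: through_lcm_def right_complement_def adjacent_def distant_def)

lemma pos_step_through_lcm:
  assumes "pos_step (a # v) (b # w)"
  shows "through_lcm a (of_word v) b (of_word w)"
  using assms
proof cases
  case distant
  then show ?thesis by (auto simp: through_lcm_distant of_word_Cons)
next
  case adjacent
  then show ?thesis by (auto simp: through_lcm_adjacent of_word_Cons)
next
  case Cons
  then show ?thesis by (auto simp: of_word_eq_iff)
qed

context
  fixes x y z :: nat
  assumes xy: "adjacent x y" and yz: "adjacent y z" and xz: "distant x z"
begin

lemma gen_path_xyzxy:
  "gen x * (gen y * (gen z * (gen x * (gen y * V)))) = gen y * (gen z * (gen x * (gen y * (gen z * V))))"
proof -
  have "gen x * (gen y * (gen z * (gen x * (gen y * V))))
    = gen x * (gen y * (gen x * (gen z * (gen y * V))))"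
    by (simp only: gen_distant_left[OF xz])
  also have "\<dots> = gen y * (gen x * (gen y * (gen z * (gen y * V))))"
    by (simp only: gen_adjacent_left[OF xy])
  also have "\<dots> = gen y * (gen x * (gen z * (gen y * (gen z * V))))"
    by (simp only: gen_adjacent_left[OF yz])
  also have "\<dots> = gen y * (gen z * (gen x * (gen y * (gen z * V))))"
    by (simp only: gen_distant_left[OF xz])
  finally show ?thesis .
qed

lemma gen_path_xyzyx:
  "gen x * (gen y * (gen z * (gen y * (gen x * V)))) = gen z * (gen y * (gen x * (gen y * (gen z * V))))"
proof -
  have "gen x * (gen y * (gen z * (gen y * (gen x * V))))
    = gen x * (gen z * (gen y * (gen z * (gen x * V))))"
    by (simp only: gen_adjacent_left[OF yz])
  also have "\<dots> = gen z * (gen x * (gen y * (gen x * (gen z * V))))"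
    by (simp only: gen_distant_left[OF xz])
  also have "\<dots> = gen z * (gen y * (gen x * (gen y * (gen z * V))))"
    by (simp only: gen_adjacent_left[OF xy])
  finally show ?thesis .
qed

lemma gen_path_yxzyx:
  "gen y * (gen x * (gen z * (gen y * (gen x * V)))) = gen z * (gen y * (gen x * (gen z * (gen y * V))))"
proof -
  have "gen y * (gen x * (gen z * (gen y * (gen x * V))))
    = gen y * (gen z * (gen x * (gen y * (gen x * V))))"
    by (simp only: gen_distant_left[OF xz])
  also have "\<dots> = gen y * (gen z * (gen y * (gen x * (gen y * V))))"
    by (simp only: gen_adjacent_left[OF xy])
  also have "\<dots> = gen z * (gen y * (gen z * (gen x * (gen y * V))))"
    by (simp only: gen_adjacent_left[OF yz])
  also have "\<dots> = gen z * (gen y * (gen x * (gen z * (gen y * V))))"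
    by (simp only: gen_distant_left[OF xz])
  finally show ?thesis .
qed

end

text \<open>Induction hypothesis of the proof that every common multiple of two generators is a multiple
  of their lcm: the claim holds for all common multiples of length at most \<open>N\<close>.\<close>

context
  fixes N :: nat
  assumes lcm_below: "\<And>a U b V. gen a * U = gen b * V \<Longrightarrow> plength U < N \<Longrightarrow> through_lcm a U b V"
begin

lemma gen_left_cancel_below: "gen a * U = gen a * V \<Longrightarrow> plength U < N \<Longrightarrow> U = V"
  using lcm_below[of a U a V] by simp

lemma gen_mult_eq_path_end_below:
  assumes ac: "distant a c" and cb: "adjacent c b" and ab: "adjacent a b"
    and eq: "gen a * Z = gen b * (gen c * Z')" and len: "plength Z < N"
  obtains U where "Z = gen b * (gen a * (gen c * (gen b * U)))" and "Z' = gen a * (gen b * (gen c * U))"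
proof -
  obtain T where Z: "Z = gen b * (gen a * T)" and cZ': "gen c * Z' = gen a * (gen b * T)"
    using lcm_below[OF eq len] ab by (auto simp: through_lcm_adjacent)
  have "plength Z' < N"
    using arg_cong[OF eq, of plength] len by simp
  then obtain S where Z': "Z' = gen a * S" and S: "gen b * T = gen c * S"
    using lcm_below[OF cZ'] ac by (auto simp: through_lcm_distant distant_sym)
  have "plength T < N"
    using Z len by simp
  then obtain U where "T = gen c * (gen b * U)" and "S = gen b * (gen c * U)"
    using lcm_below[OF S] cb by (auto simp: through_lcm_adjacent adjacent_sym)
  then show thesis using that Z Z' by simp
qed

lemma gen_mult_eq_path_middle_below:
  assumes ab: "distant a b" and ac: "adjacent a c" and cb: "adjacent c b"
    and eq: "gen a * (gen c * Z) = gen b * (gen c * Z')" and len: "plength (gen c * Z) < N"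
  obtains V where "Z = gen b * (gen c * (gen a * V))" and "Z' = gen a * (gen c * (gen b * V))"
proof -
  obtain T where cZ: "gen c * Z = gen b * T" and cZ': "gen c * Z' = gen a * T"
    using lcm_below[OF eq len] ab by (auto simp: through_lcm_distant)
  have len': "plength Z < N" "plength Z' < N"
    using arg_cong[OF eq, of plength] len by simp_all
  obtain S where Z: "Z = gen b * (gen c * S)" and T: "T = gen c * (gen b * S)"
    using lcm_below[OF cZ len'(1)] cb by (auto simp: through_lcm_adjacent)
  obtain S' where Z': "Z' = gen a * (gen c * S')" and T': "T = gen c * (gen a * S')"
    using lcm_below[OF cZ' len'(2)] ac by (auto simp: through_lcm_adjacent adjacent_sym)
  have "gen a * S' = gen b * S"
    using gen_left_cancel_below[of c] T T' Z' len'(2) by simp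
  then obtain V where "S' = gen b * V" and "S = gen a * V"
    using lcm_below[of a S' b S] ab Z' len'(2) by (auto simp: through_lcm_distant)
  then show thesis using that Z Z' by simp
qed

lemma through_lcm_trans_same:
  assumes ac: "through_lcm a X c W" and ca: "through_lcm c W a Y" and len: "plength W = N"
  shows "X = Y"
proof (cases a c rule: index_pair_cases)
  case equal
  then show ?thesis using ac ca by simp
next
  case adjacent
  obtain Z where Z: "X = gen c * (gen a * Z)" "W = gen a * (gen c * Z)"
    using ac adjacent by (auto simp: through_lcm_adjacent)
  obtain Z' where Z': "W = gen a * (gen c * Z')" "Y = gen c * (gen a * Z')"
    using ca adjacent by (auto simp: through_lcm_adjacent adjacent_sym)
  have "gen c * Z = gen c * Z'"
    using gen_left_cancel_below[of a] Z Z' len by simp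
  then have "Z = Z'"
    using gen_left_cancel_below[of c Z' Z] Z' len by simp
  then show ?thesis using Z Z' by simp
next
  case distant
  obtain Z where Z: "X = gen c * Z" "W = gen a * Z"
    using ac distant by (auto simp: through_lcm_distant)
  obtain Z' where Z': "W = gen a * Z'" "Y = gen c * Z'"
    using ca distant by (auto simp: through_lcm_distant distant_sym)
  have "Z = Z'"
    using gen_left_cancel_below[of a] Z Z' len by simp
  then show ?thesis using Z Z' by simp
qed

lemma through_lcm_trans_distant_distant:
  assumes ac: "distant a c" "through_lcm a X c W" and cb: "distant c b" "through_lcm c W b Y"
    and "a \<noteq> b" and len: "plength W = N"
  shows "through_lcm a X b Y"
proof -
  obtain Z where Z: "X = gen c * Z" "W = gen a * Z"
    using ac by (auto simp: through_lcm_distant)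
  obtain Z' where Z': "W = gen b * Z'" "Y = gen c * Z'"
    using cb by (auto simp: through_lcm_distant)
  have lcm: "through_lcm a Z b Z'"
    using lcm_below[of a Z b Z'] Z Z' len by simp
  note far = gen_distant_left[OF cb(1)] gen_distant_left[OF ac(1)[unfolded distant_sym[of a]]]
  show ?thesis
  proof (cases a b rule: index_pair_cases)
    case adjacent
    then obtain T where "Z = gen b * (gen a * T)" "Z' = gen a * (gen b * T)"
      using lcm by (auto simp: through_lcm_adjacent)
    with Z Z' far show ?thesis
      unfolding through_lcm_adjacent[OF adjacent] by (intro exI[of _ "gen c * T"]) simp
  next
    case distant
    then obtain T where "Z = gen b * T" "Z' = gen a * T"
      using lcm by (auto simp: through_lcm_distant)
    with Z Z' far show ?thesis
      unfolding through_lcm_distant[OF distant] by (intro exI[of _ "gen c * T"]) simp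
  qed (use \<open>a \<noteq> b\<close> in simp)
qed

lemma through_lcm_trans_distant_adjacent:
  assumes ac: "distant a c" "through_lcm a X c W" and cb: "adjacent c b" "through_lcm c W b Y"
    and len: "plength W = N"
  shows "through_lcm a X b Y"
proof -
  obtain Z where Z: "X = gen c * Z" "W = gen a * Z"
    using ac by (auto simp: through_lcm_distant)
  obtain Z' where Z': "W = gen b * (gen c * Z')" "Y = gen c * (gen b * Z')"
    using cb by (auto simp: through_lcm_adjacent)
  have eq: "gen a * Z = gen b * (gen c * Z')" and len_Z: "plength Z < N"
    using Z Z' len by simp_all
  have ca: "distant c a"
    using ac by (simp add: distant_sym)
  show ?thesis
  proof (cases a b rule: index_pair_cases)
    case equal
    then show ?thesis using ac cb by (auto simp: adjacent_def distant_def)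
  next
    case adjacent
    then have "adjacent b a" by (simp add: adjacent_sym)
    note path = gen_path_xyzxy[OF cb(1) this ca] gen_path_xyzyx[OF cb(1) this ca]
    obtain U where "Z = gen b * (gen a * (gen c * (gen b * U)))" "Z' = gen a * (gen b * (gen c * U))"
      using gen_mult_eq_path_end_below[OF ac(1) cb(1) adjacent eq len_Z] .
    with Z Z' path show ?thesis
      unfolding through_lcm_adjacent[OF adjacent] by (intro exI[of _ "gen c * (gen b * (gen a * U))"]) simp
  next
    case distant
    obtain T where T: "Z = gen b * T" "gen c * Z' = gen a * T"
      using lcm_below[OF eq len_Z] distant by (auto simp: through_lcm_distant)
    moreover have "plength Z' < N"
      using Z' len by simp
    ultimately obtain S where "Z' = gen a * S" "T = gen c * S"
      using lcm_below[of c Z' a T] ca by (auto simp: through_lcm_distant)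
    with Z Z' T show ?thesis
      unfolding through_lcm_distant[OF distant]
      by (intro exI[of _ "gen c * (gen b * S)"])
        (simp add: gen_adjacent_left[OF cb(1)] gen_distant_left[OF distant] gen_distant_left[OF ac(1)])
  qed
qed

text \<open>Here \<open>a\<close> and \<open>b\<close> cannot be adjacent, because the Coxeter graph of type A contains no triangle.\<close>

lemma through_lcm_trans_adjacent_adjacent:
  assumes ac: "adjacent a c" "through_lcm a X c W" and cb: "adjacent c b" "through_lcm c W b Y"
    and "a \<noteq> b" and len: "plength W = N"
  shows "through_lcm a X b Y"
proof -
  have ab: "distant a b"
    using ac(1) cb(1) \<open>a \<noteq> b\<close> by (auto simp: adjacent_def distant_def)
  then have ba: "distant b a" and bc: "adjacent b c" and ca: "adjacent c a"
    using ac(1) cb(1) by (simp_all add: distant_sym adjacent_sym)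
  obtain Z where Z: "X = gen c * (gen a * Z)" "W = gen a * (gen c * Z)"
    using ac by (auto simp: through_lcm_adjacent)
  obtain Z' where Z': "W = gen b * (gen c * Z')" "Y = gen c * (gen b * Z')"
    using cb by (auto simp: through_lcm_adjacent)
  have "gen a * (gen c * Z) = gen b * (gen c * Z')" "plength (gen c * Z) < N"
    using Z Z' len by simp_all
  then obtain V where "Z = gen b * (gen c * (gen a * V))" "Z' = gen a * (gen c * (gen b * V))"
    using gen_mult_eq_path_middle_below[OF ab ac(1) cb(1)] by blast
  then have X: "X = gen c * (gen a * (gen b * (gen c * (gen a * V))))"
    and Y: "Y = gen c * (gen b * (gen a * (gen c * (gen b * V))))"
    using Z Z' by simp_all
  have "X = gen b * (gen c * (gen a * (gen b * (gen c * V))))"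
    unfolding X by (rule gen_path_yxzyx[OF ac(1) cb(1) ab])
  moreover have "Y = gen a * (gen c * (gen a * (gen b * (gen c * V))))"
    unfolding Y gen_distant_left[OF ab] by (rule gen_path_yxzyx[OF bc ca ba])
  ultimately show ?thesis
    by (auto simp: through_lcm_distant[OF ab])
qed

lemma through_lcm_trans:
  assumes ac: "through_lcm a X c W" and cb: "through_lcm c W b Y" and len: "plength W = N"
  shows "through_lcm a X b Y"
proof -
  consider (trivial_step) "a = c \<or> c = b" | (same) "a = b"
    | (adjacent_adjacent) "a \<noteq> b" "adjacent a c" "adjacent c b"
    | (distant_distant) "a \<noteq> b" "distant a c" "distant c b"
    | (distant_adjacent) "distant a c" "adjacent c b"
    | (adjacent_distant) "adjacent a c" "distant c b"
    by (metis index_pair_cases)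
  then show ?thesis
  proof cases
    case trivial_step
    then show ?thesis using ac cb by auto
  next
    case same
    then show ?thesis using through_lcm_trans_same ac cb len by simp
  next
    case adjacent_adjacent
    then show ?thesis using through_lcm_trans_adjacent_adjacent ac cb len by blast
  next
    case distant_distant
    then show ?thesis using through_lcm_trans_distant_distant ac cb len by blast
  next
    case distant_adjacent
    then show ?thesis using through_lcm_trans_distant_adjacent ac cb len by blast
  next
    case adjacent_distant
    then have "through_lcm b Y a X"
      using through_lcm_trans_distant_adjacent[of b c Y W a X] ac cb len
      by (simp add: adjacent_sym distant_sym through_lcm_sym)
    then show ?thesis by (simp add: through_lcm_sym)
  qed
qed

end

theorem gen_mult_eq_through_lcm:
  assumes "gen a * X = gen b * Y"
  shows "through_lcm a X b Y"
  using assms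
proof (induction "plength X" arbitrary: a X b Y rule: less_induct)
  case less
  define v where "v = rep_pbraid X"
  have X: "X = of_word v" by (simp add: v_def)
  have "through_lcm a X b (of_word w)" if "pos_eq (a # v) (b # w)" for w
    using that
  proof (induction "b # w" arbitrary: b w rule: rtranclp_induct)
    case base
    then show ?case by (simp add: X)
  next
    case (step u)
    then obtain c w' where u: "u = c # w'"
      by (metis pos_step_length_set length_0_conv list.distinct(1) neq_Nil_conv)
    have "length v = length w'"
      using step.hyps(1) pos_eq_length u by fastforce
    then have "plength (of_word w') = plength X"
      by (simp add: X)
    then show ?case
      using through_lcm_trans[OF less.hyps step.hyps(3)[OF u]] pos_step_through_lcm step.hyps(2) u
      by blast
  qed
  moreover have "pos_eq (a # v) (b # rep_pbraid Y)"
    using less.prems by (simp add: X of_word_Cons flip: of_word_eq_iff)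
  ultimately show ?case by fastforce
qed

lemma gen_left_cancel: "gen a * X = gen a * Y \<Longrightarrow> X = Y"
  using gen_mult_eq_through_lcm by fastforce

lemma pbraid_left_cancel:
  fixes U X Y :: pbraid
  shows "U * X = U * Y \<Longrightarrow> X = Y"
  by (induction U rule: pbraid_induct) (auto simp: mult.assoc dest: gen_left_cancel)

section \<open>Conjugating powers of generators by positive braids\<close>

lemma adjacent_gen_dvd_power_mult:
  assumes "adjacent r t" and "m \<ge> 1" and "gen r * Y = gen t ^ m * X"
  obtains Z where "X = gen r * (gen t * Z)"
  using assms(2,3)
proof (induction m arbitrary: Y thesis rule: dec_induct)
  case base
  then show ?case
    using gen_mult_eq_through_lcm[of r Y t X] assms(1) by (auto simp: through_lcm_adjacent)
next
  case (step k)
  have "gen r * Y = gen t * (gen t ^ k * X)"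
    using step.prems by (simp add: mult.assoc)
  from gen_mult_eq_through_lcm[OF this] obtain Z where "gen r * (gen t * Z) = gen t ^ k * X"
    using assms(1) by (auto simp: through_lcm_adjacent)
  then show ?case using step.IH step.prems(1) by blast
qed

lemma gen_power_adjacent:
  "adjacent r t \<Longrightarrow> gen t ^ m * (gen r * gen t) = gen r * gen t * gen r ^ m"
proof (induction m)
  case (Suc m)
  then show ?case by (metis gen_adjacent mult.assoc power_Suc power_Suc2)
qed simp

lemma gen_power_intertwiner_adjacentE:
  assumes "adjacent r t" and "m \<ge> 1" and eq: "gen r * V * gen s ^ m = gen t ^ m * (gen r * V)"
  obtains Z where "V = gen t * Z" and "Z * gen s ^ m = gen r ^ m * Z"
proof -
  have "gen r * (V * gen s ^ m) = gen t ^ m * (gen r * V)"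
    using eq by (simp add: mult.assoc)
  then obtain Z where "gen r * V = gen r * (gen t * Z)"
    using adjacent_gen_dvd_power_mult assms(1,2) by metis
  then have V: "V = gen t * Z"
    by (rule gen_left_cancel)
  have "gen r * gen t * (Z * gen s ^ m) = gen r * gen t * (gen r ^ m * Z)"
    using eq V gen_power_adjacent[OF assms(1)] by (metis mult.assoc)
  then have "Z * gen s ^ m = gen r ^ m * Z"
    by (rule pbraid_left_cancel)
  with V show thesis by (rule that)
qed

theorem gen_power_intertwiner:
  assumes "m \<ge> 1" and "U * gen s ^ m = gen t ^ m * U"
  shows "U * gen s = gen t * U"
  using assms(2)
proof (induction "plength U" arbitrary: U t rule: less_induct)
  case less
  show ?case
  proof (cases U rule: pbraid_cases)
    case one
    then have "letters (gen s ^ m) = letters (gen t ^ m)"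
      using less.prems by simp
    then show ?thesis using one assms(1) by (simp add: letters_power)
  next
    case (gen_mult r V)
    show ?thesis
    proof (cases "adjacent r t")
      case False
      then have comm: "gen t * gen r = gen r * gen t"
        using gen_distant by (metis index_pair_cases)
      then have "gen t ^ m * gen r = gen r * gen t ^ m"
        by (rule power_commuting_commutes)
      then have "V * gen s ^ m = gen t ^ m * V"
        using less.prems gen_mult gen_left_cancel by (metis mult.assoc)
      then have "V * gen s = gen t * V"
        using less.hyps gen_mult by simp
      then show ?thesis using comm gen_mult by (metis mult.assoc)
    next
      case True
      obtain Z where V: "V = gen t * Z" and "Z * gen s ^ m = gen r ^ m * Z"
        using gen_power_intertwiner_adjacentE[OF True assms(1)] less.prems gen_mult by blast
      then have "Z * gen s = gen r * Z"
        using less.hyps gen_mult by simp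
      then show ?thesis using gen_mult V gen_adjacent[OF True] by (metis mult.assoc)
    qed
  qed
qed

section \<open>The full twist\<close>

definition positive_braids :: "nat \<Rightarrow> pbraid set" where
  "positive_braids n = {X. letters X \<subseteq> {1..<n}}"

lemma of_word_positive_iff: "of_word w \<in> positive_braids n \<longleftrightarrow> set w \<subseteq> {1..<n}"
  by (simp add: positive_braids_def)

lemma one_positive [simp]: "1 \<in> positive_braids n"
  by (simp add: positive_braids_def)

lemma gen_positive_iff [simp]: "gen i \<in> positive_braids n \<longleftrightarrow> 1 \<le> i \<and> i < n"
  by (simp add: positive_braids_def)

lemma mult_positive_iff [simp]:
  "X * Y \<in> positive_braids n \<longleftrightarrow> X \<in> positive_braids n \<and> Y \<in> positive_braids n"
  by (auto simp: positive_braids_def)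

lemma power_positive [simp]: "X \<in> positive_braids n \<Longrightarrow> X ^ k \<in> positive_braids n"
  by (simp add: positive_braids_def letters_power)

lemma gen_commute_distant:
  "(\<And>j. j \<in> letters X \<Longrightarrow> distant i j) \<Longrightarrow> gen i * X = X * gen i"
proof (induction X rule: pbraid_induct)
  case (gen_mult a Y)
  have "gen i * (gen a * Y) = gen a * (gen i * Y)"
    using gen_mult.prems by (intro gen_distant_left) simp
  also have "\<dots> = gen a * Y * gen i"
    using gen_mult by (simp add: mult.assoc)
  finally show ?case .
qed simp

definition coxeter_elt :: "nat \<Rightarrow> pbraid" where
  "coxeter_elt n = of_word [1..<n]"

lemma coxeter_elt_positive [simp]: "coxeter_elt n \<in> positive_braids n"
  by (simp add: coxeter_elt_def of_word_positive_iff)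

lemma coxeter_elt_first:
  assumes "n \<ge> 2"
  shows "coxeter_elt n = gen 1 * of_word [2..<n]"
proof -
  have "[1..<n] = 1 # [2..<n]"
    using assms by (simp add: upt_conv_Cons numeral_2_eq_2)
  then show ?thesis by (simp add: coxeter_elt_def of_word_Cons)
qed

lemma coxeter_elt_last:
  assumes "n \<ge> 2"
  shows "coxeter_elt n = of_word [1..<n - 1] * gen (n - 1)"
proof -
  have "[1..<n] = [1..<n - 1] @ [n - 1]"
    using assms upt_Suc_append[of 1 "n - 1"] by simp
  then show ?thesis by (simp add: coxeter_elt_def of_word_append of_word_Cons)
qed

lemma coxeter_elt_shift:
  assumes "1 \<le> i" and "i + 1 < n"
  shows "coxeter_elt n * gen i = gen (i + 1) * coxeter_elt n"
proof -
  define A B where "A = of_word [1..<i]" and "B = of_word [i+2..<n]"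
  have "[1..<n] = [1..<i] @ i # (i + 1) # [i+2..<n]"
    using assms upt_add_eq_append[of 1 i "n - i"] by (simp add: upt_conv_Cons)
  then have split: "coxeter_elt n = A * (gen i * (gen (i + 1) * B))"
    by (simp add: coxeter_elt_def A_def B_def of_word_append of_word_Cons)
  have A: "gen (i + 1) * A = A * gen (i + 1)"
    unfolding A_def by (rule gen_commute_distant) (auto simp: distant_def)
  have B: "gen i * B = B * gen i"
    unfolding B_def by (rule gen_commute_distant) (auto simp: distant_def)
  have "coxeter_elt n * gen i = A * (gen i * (gen (i + 1) * (gen i * B)))"
    by (simp add: split B mult.assoc)
  also have "\<dots> = A * (gen (i + 1) * (gen i * (gen (i + 1) * B)))"
    using gen_adjacent_left[of i "i + 1"] by (simp add: adjacent_def)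
  also have "\<dots> = gen (i + 1) * coxeter_elt n"
    using A by (simp add: split flip: mult.assoc)
  finally show ?thesis .
qed

lemma coxeter_elt_shift_word:
  assumes "set w \<subseteq> {1..<n - 1}"
  shows "coxeter_elt n * of_word w = of_word (map Suc w) * coxeter_elt n"
  using assms
proof (induction w)
  case (Cons a w)
  have "coxeter_elt n * of_word (a # w) = coxeter_elt n * gen a * of_word w"
    by (simp add: of_word_Cons mult.assoc)
  also have "coxeter_elt n * gen a = gen (Suc a) * coxeter_elt n"
    using Cons.prems coxeter_elt_shift[of a n] by fastforce
  also have "gen (Suc a) * coxeter_elt n * of_word w = gen (Suc a) * (coxeter_elt n * of_word w)"
    by (rule mult.assoc)
  also have "\<dots> = of_word (map Suc (a # w)) * coxeter_elt n"
    using Cons by (simp add: of_word_Cons mult.assoc)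
  finally show ?case .
qed simp

lemma coxeter_elt_power_shift:
  assumes "1 \<le> i" and "i + k < n"
  shows "coxeter_elt n ^ k * gen i = gen (i + k) * coxeter_elt n ^ k"
  using assms(2)
proof (induction k)
  case (Suc k)
  have "coxeter_elt n ^ Suc k * gen i = coxeter_elt n * gen (i + k) * coxeter_elt n ^ k"
    using Suc by (simp add: mult.assoc)
  also have "\<dots> = gen (i + Suc k) * coxeter_elt n ^ Suc k"
    using Suc.prems assms(1) coxeter_elt_shift[of "i + k" n] by (simp add: mult.assoc)
  finally show ?case .
qed simp

lemma coxeter_elt_square_wrap:
  assumes "n \<ge> 2"
  shows "coxeter_elt n ^ 2 * gen (n - 1) = gen 1 * coxeter_elt n ^ 2"
proof -
  let ?\<delta> = "coxeter_elt n"
  have "?\<delta> ^ 2 * gen (n - 1) = gen 1 * (of_word [2..<n] * ?\<delta>) * gen (n - 1)"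
    by (subst power2_eq_square, subst coxeter_elt_first[OF assms]) (simp add: mult.assoc)
  also have "of_word [2..<n] * ?\<delta> = ?\<delta> * of_word [1..<n - 1]"
    using coxeter_elt_shift_word[of "[1..<n - 1]" n] assms by (simp add: map_Suc_upt numeral_2_eq_2)
  also have "gen 1 * (?\<delta> * of_word [1..<n - 1]) * gen (n - 1) = gen 1 * ?\<delta> ^ 2"
    using coxeter_elt_last[OF assms] by (simp add: power2_eq_square mult.assoc)
  finally show ?thesis .
qed

definition full_twist :: "nat \<Rightarrow> pbraid" where
  "full_twist n = coxeter_elt n ^ n"

lemma full_twist_positive [simp]: "full_twist n \<in> positive_braids n"
  by (simp add: full_twist_def)

lemma full_twist_gen_commute:
  assumes "1 \<le> i" and "i < n"
  shows "full_twist n * gen i = gen i * full_twist n"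
proof -
  let ?\<delta> = "coxeter_elt n"
  have n: "n = (i - 1) + 2 + (n - 1 - i)"
    using assms by simp
  have split: "full_twist n = ?\<delta> ^ (i - 1) * (?\<delta> ^ 2 * ?\<delta> ^ (n - 1 - i))"
    unfolding full_twist_def by (subst n, simp only: power_add mult.assoc)
  have shift_to_last: "?\<delta> ^ (n - 1 - i) * gen i = gen (n - 1) * ?\<delta> ^ (n - 1 - i)"
    using coxeter_elt_power_shift[of i "n - 1 - i" n] assms by simp
  have wrap: "?\<delta> ^ 2 * gen (n - 1) = gen 1 * ?\<delta> ^ 2"
    using coxeter_elt_square_wrap assms by simp
  have shift_from_first: "?\<delta> ^ (i - 1) * gen 1 = gen i * ?\<delta> ^ (i - 1)"
    using coxeter_elt_power_shift[of 1 "i - 1" n] assms by simp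
  have "full_twist n * gen i = ?\<delta> ^ (i - 1) * (?\<delta> ^ 2 * (?\<delta> ^ (n - 1 - i) * gen i))"
    by (simp only: split mult.assoc)
  also have "\<dots> = ?\<delta> ^ (i - 1) * ((?\<delta> ^ 2 * gen (n - 1)) * ?\<delta> ^ (n - 1 - i))"
    by (simp only: shift_to_last mult.assoc)
  also have "\<dots> = (?\<delta> ^ (i - 1) * gen 1) * (?\<delta> ^ 2 * ?\<delta> ^ (n - 1 - i))"
    by (simp only: wrap mult.assoc)
  also have "\<dots> = gen i * full_twist n"
    by (simp only: shift_from_first split mult.assoc)
  finally show ?thesis .
qed

lemma full_twist_power_commute:
  assumes "X \<in> positive_braids n"
  shows "full_twist n ^ k * X = X * full_twist n ^ k"
proof -
  have "full_twist n * X = X * full_twist n"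
    using assms
  proof (induction X rule: pbraid_induct)
    case (gen_mult a Y)
    have "full_twist n * (gen a * Y) = gen a * (full_twist n * Y)"
      using gen_mult.prems full_twist_gen_commute[of a n] by (simp flip: mult.assoc)
    also have "\<dots> = gen a * Y * full_twist n"
      using gen_mult by (simp add: mult.assoc)
    finally show ?case .
  qed simp
  then show ?thesis by (rule power_commuting_commutes)
qed

definition cofactor :: "nat \<Rightarrow> nat \<Rightarrow> pbraid" where
  "cofactor n i = coxeter_elt n ^ (i - 1) * of_word [2..<n] * coxeter_elt n ^ (n - i)"

lemma cofactor_positive [simp]: "cofactor n i \<in> positive_braids n"
  by (auto simp: cofactor_def of_word_positive_iff)

lemma gen_mult_cofactor:
  assumes "1 \<le> i" and "i < n"
  shows "gen i * cofactor n i = full_twist n"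
proof -
  let ?\<delta> = "coxeter_elt n"
  have "gen i * cofactor n i = (gen i * ?\<delta> ^ (i - 1)) * (of_word [2..<n] * ?\<delta> ^ (n - i))"
    by (simp add: cofactor_def mult.assoc)
  also have "gen i * ?\<delta> ^ (i - 1) = ?\<delta> ^ (i - 1) * gen 1"
    using coxeter_elt_power_shift[of 1 "i - 1" n] assms by simp
  also have "\<dots> * (of_word [2..<n] * ?\<delta> ^ (n - i))
      = ?\<delta> ^ (i - 1) * ((gen 1 * of_word [2..<n]) * ?\<delta> ^ (n - i))"
    by (simp only: mult.assoc)
  also have "gen 1 * of_word [2..<n] = ?\<delta>"
    using assms by (simp add: coxeter_elt_first)
  also have "?\<delta> ^ (i - 1) * (?\<delta> * ?\<delta> ^ (n - i)) = ?\<delta> ^ ((i - 1) + Suc (n - i))"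
    by (simp only: power_add power_Suc)
  also have "\<dots> = full_twist n"
    using assms by (simp add: full_twist_def)
  finally show ?thesis .
qed

lemma cofactor_mult_gen:
  assumes "1 \<le> i" and "i < n"
  shows "cofactor n i * gen i = full_twist n"
proof (rule gen_left_cancel[of i])
  show "gen i * (cofactor n i * gen i) = gen i * full_twist n"
    using gen_mult_cofactor[OF assms] full_twist_gen_commute[OF assms] by (simp flip: mult.assoc)
qed

section \<open>Braid words as fractions of positive braids\<close>

text \<open>A braid word \<open>w\<close> represents the fraction with numerator \<open>numerator n w\<close> and denominator
  the full twist to the power \<open>neg_count w\<close>: each inverse letter \<open>(i, False)\<close> is replaced by the
  cofactor of \<open>i\<close> in the full twist.\<close>

definition numerator :: "nat \<Rightarrow> bword \<Rightarrow> pbraid" where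
  "numerator n w = prod_list (map (\<lambda>(i, b). if b then gen i else cofactor n i) w)"

definition neg_count :: "bword \<Rightarrow> nat" where
  "neg_count w = length (filter (\<lambda>(i, b). \<not> b) w)"

definition pos_word :: "nat list \<Rightarrow> bword" where
  "pos_word w = map (\<lambda>i. (i, True)) w"

lemma numerator_simps [simp]:
  "numerator n [] = 1"
  "numerator n ((i, b) # w) = (if b then gen i else cofactor n i) * numerator n w"
  by (simp_all add: numerator_def)

lemma neg_count_simps [simp]:
  "neg_count [] = 0"
  "neg_count ((i, b) # w) = (if b then 0 else 1) + neg_count w"
  by (simp_all add: neg_count_def)

lemma numerator_append: "numerator n (v @ w) = numerator n v * numerator n w"
  by (simp add: numerator_def)

lemma neg_count_append: "neg_count (v @ w) = neg_count v + neg_count w"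
  by (simp add: neg_count_def)

lemma pos_word_simps [simp]:
  "pos_word [] = []"
  "pos_word (i # w) = (i, True) # pos_word w"
  by (simp_all add: pos_word_def)

lemma pos_word_append: "pos_word (v @ w) = pos_word v @ pos_word w"
  by (simp add: pos_word_def)

lemma numerator_pos_word [simp]: "numerator n (pos_word w) = of_word w"
  by (induction w) (simp_all add: of_word_Cons)

lemma neg_count_pos_word [simp]: "neg_count (pos_word w) = 0"
  by (induction w) simp_all

lemma braid_wf_Nil [simp]: "braid_wf n []"
  by (simp add: braid_wf_def)

lemma braid_wf_Cons [simp]: "braid_wf n ((i, b) # w) \<longleftrightarrow> 1 \<le> i \<and> i < n \<and> braid_wf n w"
  by (auto simp: braid_wf_def)

lemma braid_wf_append [simp]: "braid_wf n (v @ w) \<longleftrightarrow> braid_wf n v \<and> braid_wf n w"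
  by (auto simp: braid_wf_def)

lemma braid_wf_pos_word [simp]: "braid_wf n (pos_word w) \<longleftrightarrow> of_word w \<in> positive_braids n"
  by (induction w) (auto simp: of_word_Cons)

lemma braid_eq_wf: "braid_eq n v w \<Longrightarrow> braid_wf n v \<longleftrightarrow> braid_wf n w"
  by (induction rule: braid_eq.induct) auto

lemma numerator_positive: "braid_wf n w \<Longrightarrow> numerator n w \<in> positive_braids n"
  by (induction w) auto

lemma cross_multiplication_trans:
  fixes Z :: pbraid
  assumes XY: "Z ^ b * X = Z ^ a * Y" and YW: "Z ^ c * Y = Z ^ b * W"
  shows "Z ^ c * X = Z ^ a * W"
proof (rule pbraid_left_cancel)
  have swap: "Z ^ i * (Z ^ j * V) = Z ^ j * (Z ^ i * V)" for i j V
    by (simp add: add.commute flip: mult.assoc power_add)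
  have "Z ^ b * (Z ^ c * X) = Z ^ c * (Z ^ a * Y)"
    unfolding swap[of b] XY ..
  also have "\<dots> = Z ^ b * (Z ^ a * W)"
    unfolding swap[of c] YW swap[of a] ..
  finally show "Z ^ b * (Z ^ c * X) = Z ^ b * (Z ^ a * W)" .
qed

lemma full_twist_power_mult_numerator_append:
  assumes "braid_wf n u"
  shows "full_twist n ^ neg_count (u @ x @ v) * numerator n (u @ y @ v) =
    full_twist n ^ (neg_count u + neg_count v) *
      (numerator n u * ((full_twist n ^ neg_count x * numerator n y) * numerator n v))"
proof -
  let ?Z = "full_twist n"
  have "?Z ^ neg_count (u @ x @ v) = ?Z ^ (neg_count u + neg_count v) * ?Z ^ neg_count x"
    by (simp add: neg_count_append ac_simps flip: power_add)
  then have "?Z ^ neg_count (u @ x @ v) * numerator n (u @ y @ v) =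
      ?Z ^ (neg_count u + neg_count v) *
        ((?Z ^ neg_count x * numerator n u) * (numerator n y * numerator n v))"
    by (simp only: numerator_append mult.assoc)
  also have "?Z ^ neg_count x * numerator n u = numerator n u * ?Z ^ neg_count x"
    using assms by (intro full_twist_power_commute numerator_positive)
  finally show ?thesis
    by (simp only: mult.assoc)
qed

lemma braid_eq_numerator:
  assumes "braid_eq n x y" and "braid_wf n x"
  shows "full_twist n ^ neg_count y * numerator n x = full_twist n ^ neg_count x * numerator n y"
  using assms
proof (induction rule: braid_eq.induct)
  case (sym x y)
  then show ?case using braid_eq_wf by metis
next
  case (trans x y z)
  then show ?case using braid_eq_wf cross_multiplication_trans by metis
next
  case (cong x y u v)
  then show ?case by (simp add: full_twist_power_mult_numerator_append)
next
  case (cancel i b)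
  then show ?case by (cases b) (simp_all add: gen_mult_cofactor cofactor_mult_gen)
next
  case (far_comm i j)
  then show ?case using gen_distant[of i j] by (simp add: distant_def)
next
  case (braid i)
  then show ?case using gen_adjacent[of i "i + 1"] by (simp add: adjacent_def mult.assoc)
qed simp

lemma braid_eq_append:
  assumes "braid_eq n x x'" and "braid_eq n y y'"
  shows "braid_eq n (x @ y) (x' @ y')"
  using braid_eq.cong[OF assms(1), of "[]" y] braid_eq.cong[OF assms(2), of x' "[]"]
  by (auto intro: braid_eq.trans)

lemma braid_eq_distant:
  assumes "distant i j" and "i \<in> {1..<n}" and "j \<in> {1..<n}"
  shows "braid_eq n [(i, True), (j, True)] [(j, True), (i, True)]"
proof (cases "i < j")
  case True
  with assms show ?thesis by (intro braid_eq.far_comm) (auto simp: distant_def)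
next
  case False
  with assms show ?thesis by (intro braid_eq.sym[OF braid_eq.far_comm]) (auto simp: distant_def)
qed

lemma braid_eq_adjacent:
  assumes "adjacent i j" and "i \<in> {1..<n}" and "j \<in> {1..<n}"
  shows "braid_eq n [(i, True), (j, True), (i, True)] [(j, True), (i, True), (j, True)]"
proof (cases "i < j")
  case True
  then have "j = i + 1" using assms(1) by (auto simp: adjacent_def)
  with assms show ?thesis using braid_eq.braid[of i n] by auto
next
  case False
  then have "i = j + 1" using assms(1) by (auto simp: adjacent_def)
  with assms show ?thesis using braid_eq.sym[OF braid_eq.braid[of j n]] by auto
qed

lemma pos_step_braid_eq:
  assumes "pos_step v w" and "set v \<subseteq> {1..<n}"
  shows "braid_eq n (pos_word v) (pos_word w)"
  using assms
proof (induction rule: pos_step.induct)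
  case (distant i j w)
  then show ?case
    using braid_eq.cong[OF braid_eq_distant[of i j n], of "[]" "pos_word w"] by simp
next
  case (adjacent i j w)
  then show ?case
    using braid_eq.cong[OF braid_eq_adjacent[of i j n], of "[]" "pos_word w"] by simp
next
  case (Cons v w a)
  then show ?case
    using braid_eq.cong[of n "pos_word v" "pos_word w" "[(a, True)]" "[]"] by simp
qed

lemma pos_eq_braid_eq:
  assumes "pos_eq v w" and "set v \<subseteq> {1..<n}"
  shows "braid_eq n (pos_word v) (pos_word w)"
  using assms
proof (induction rule: rtranclp_induct)
  case base
  show ?case by (rule braid_eq.refl)
next
  case (step v' w)
  have "set v' \<subseteq> {1..<n}"
    using pos_eq_set[OF step.hyps(1)] step.prems by simp
  with step show ?case
    by (blast intro: braid_eq.trans pos_step_braid_eq)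
qed

theorem pos_word_braid_eq_iff:
  assumes "of_word v \<in> positive_braids n"
  shows "braid_eq n (pos_word v) (pos_word w) \<longleftrightarrow> of_word v = of_word w"
proof
  assume "braid_eq n (pos_word v) (pos_word w)"
  then show "of_word v = of_word w"
    using braid_eq_numerator assms by fastforce
next
  assume "of_word v = of_word w"
  then show "braid_eq n (pos_word v) (pos_word w)"
    using pos_eq_braid_eq assms by (simp add: of_word_eq_iff of_word_positive_iff)
qed

section \<open>The braid group\<close>

lemma braid_class_eq_iff:
  assumes "braid_wf n w"
  shows "braid_class n v = braid_class n w \<longleftrightarrow> braid_eq n v w"
  using assms braid_eq.refl braid_eq.sym braid_eq.trans
  unfolding braid_class_def by blast

lemma braid_class_mult:
  assumes "braid_wf n v" and "braid_wf n w"
  shows "braid_class n v \<otimes>\<^bsub>braid_group n\<^esub> braid_class n w = braid_class n (v @ w)"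
proof -
  have eq: "braid_class n (a @ b) = braid_class n (v @ w)"
    if "a \<in> braid_class n v" "b \<in> braid_class n w" for a b
  proof -
    have "braid_eq n a v" "braid_eq n b w"
      using that by (auto simp: braid_class_def intro: braid_eq.sym)
    then show ?thesis
      using assms by (simp add: braid_class_eq_iff braid_eq_append)
  qed
  have "v \<in> braid_class n v" "w \<in> braid_class n w"
    using assms braid_eq.refl by (auto simp: braid_class_def)
  then have "(\<Union>a\<in>braid_class n v. \<Union>b\<in>braid_class n w. braid_class n (a @ b)) = braid_class n (v @ w)"
    using eq by blast
  then show ?thesis
    by (simp add: braid_group_def braid_mult_def)
qed

lemma braid_class_carrier [simp]: "braid_wf n w \<Longrightarrow> braid_class n w \<in> carrier (braid_group n)"
  by (simp add: braid_group_def)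

lemma braid_carrierE:
  assumes "g \<in> carrier (braid_group n)"
  obtains w where "braid_wf n w" and "g = braid_class n w"
  using assms by (auto simp: braid_group_def)

lemma braid_group_one: "\<one>\<^bsub>braid_group n\<^esub> = braid_class n []"
  by (simp add: braid_group_def)

lemma braid_eq_left_inverse:
  assumes "braid_wf n w"
  shows "\<exists>v. braid_wf n v \<and> braid_eq n (v @ w) []"
  using assms
proof (induction w)
  case (Cons a w)
  obtain i b where a: "a = (i, b)" by force
  obtain v where v: "braid_wf n v" "braid_eq n (v @ w) []"
    using Cons a by auto
  have "braid_eq n [(i, \<not> b), (i, b)] []"
    using Cons.prems a braid_eq.cancel[of i n "\<not> b"] by simp
  from braid_eq.cong[OF this, of v w] have "braid_eq n ((v @ [(i, \<not> b)]) @ a # w) []"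
    using v(2) a by (auto intro: braid_eq.trans)
  then show ?case using v(1) Cons.prems a by (intro exI[of _ "v @ [(i, \<not> b)]"]) auto
qed (auto intro: exI[of _ "[]"] braid_eq.refl)

lemma group_braid_group: "group (braid_group n)"
proof (rule groupI)
  fix x y z
  assume "x \<in> carrier (braid_group n)" "y \<in> carrier (braid_group n)" "z \<in> carrier (braid_group n)"
  then show "x \<otimes>\<^bsub>braid_group n\<^esub> y \<otimes>\<^bsub>braid_group n\<^esub> z = x \<otimes>\<^bsub>braid_group n\<^esub> (y \<otimes>\<^bsub>braid_group n\<^esub> z)"
    by (auto elim!: braid_carrierE simp: braid_class_mult)
next
  fix x assume "x \<in> carrier (braid_group n)"
  then obtain w where w: "braid_wf n w" "x = braid_class n w" by (rule braid_carrierE)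
  then obtain v where v: "braid_wf n v" "braid_eq n (v @ w) []"
    using braid_eq_left_inverse by blast
  then have "braid_class n v \<otimes>\<^bsub>braid_group n\<^esub> x = \<one>\<^bsub>braid_group n\<^esub>"
    using w by (simp add: braid_class_mult braid_group_one braid_class_eq_iff)
  then show "\<exists>y\<in>carrier (braid_group n). y \<otimes>\<^bsub>braid_group n\<^esub> x = \<one>\<^bsub>braid_group n\<^esub>"
    using v(1) by auto
qed (auto elim!: braid_carrierE simp: braid_class_mult braid_group_one)

lemma braid_sigma_carrier [simp]:
  "1 \<le> i \<Longrightarrow> i < n \<Longrightarrow> braid_sigma n i \<in> carrier (braid_group n)"
  by (simp add: braid_sigma_def)

definition pbraid_class :: "nat \<Rightarrow> pbraid \<Rightarrow> bword set" where
  "pbraid_class n X = braid_class n (pos_word (rep_pbraid X))"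

lemma pbraid_class_carrier [simp]: "X \<in> positive_braids n \<Longrightarrow> pbraid_class n X \<in> carrier (braid_group n)"
  by (simp add: pbraid_class_def)

lemma pbraid_class_of_word:
  "of_word w \<in> positive_braids n \<Longrightarrow> pbraid_class n (of_word w) = braid_class n (pos_word w)"
  by (simp add: pbraid_class_def braid_class_eq_iff pos_word_braid_eq_iff)

theorem inj_on_pbraid_class: "inj_on (pbraid_class n) (positive_braids n)"
proof (rule inj_onI)
  fix X Y assume "X \<in> positive_braids n" "Y \<in> positive_braids n" and "pbraid_class n X = pbraid_class n Y"
  then show "X = Y"
    by (simp add: pbraid_class_def braid_class_eq_iff pos_word_braid_eq_iff)
qed

lemma pbraid_class_one: "pbraid_class n 1 = \<one>\<^bsub>braid_group n\<^esub>"
  using pbraid_class_of_word[of "[]" n] by (simp add: braid_group_one)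

lemma pbraid_class_gen: "1 \<le> i \<Longrightarrow> i < n \<Longrightarrow> pbraid_class n (gen i) = braid_sigma n i"
  using pbraid_class_of_word[of "[i]" n] by (simp add: braid_sigma_def of_word_Cons)

lemma pbraid_class_mult:
  assumes "X \<in> positive_braids n" and "Y \<in> positive_braids n"
  shows "pbraid_class n (X * Y) = pbraid_class n X \<otimes>\<^bsub>braid_group n\<^esub> pbraid_class n Y"
proof -
  let ?w = "rep_pbraid X @ rep_pbraid Y"
  have "pbraid_class n (X * Y) = pbraid_class n (of_word ?w)"
    by (simp add: of_word_append)
  also have "\<dots> = braid_class n (pos_word ?w)"
    using assms by (intro pbraid_class_of_word) (simp add: of_word_append)
  also have "\<dots> = pbraid_class n X \<otimes>\<^bsub>braid_group n\<^esub> pbraid_class n Y"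
    using assms by (simp add: pbraid_class_def braid_class_mult pos_word_append)
  finally show ?thesis .
qed

lemma pbraid_class_power:
  "X \<in> positive_braids n \<Longrightarrow> pbraid_class n (X ^ k) = pbraid_class n X [^]\<^bsub>braid_group n\<^esub> k"
  by (induction k) (simp_all add: pbraid_class_one pbraid_class_mult power_Suc2 del: power_Suc)

lemma full_twist_power_mult_letter:
  assumes "1 \<le> i" and "i < n"
  shows "pbraid_class n (full_twist n ^ neg_count [(i, b)]) \<otimes>\<^bsub>braid_group n\<^esub> braid_class n [(i, b)]
       = pbraid_class n (numerator n [(i, b)])"
proof (cases b)
  interpret group "braid_group n" by (rule group_braid_group)
  case True
  then show ?thesis using assms by (simp add: pbraid_class_one pbraid_class_gen braid_sigma_def)
next
  interpret group "braid_group n" by (rule group_braid_group)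
  case False
  let ?G = "braid_group n" and ?c = "pbraid_class n (cofactor n i)" and ?inv = "braid_class n [(i, False)]"
  have "braid_sigma n i \<otimes>\<^bsub>?G\<^esub> ?inv = \<one>\<^bsub>?G\<^esub>"
    using assms braid_eq.cancel[of i n True]
    by (simp add: braid_sigma_def braid_class_mult braid_group_one braid_class_eq_iff)
  then have "(?c \<otimes>\<^bsub>?G\<^esub> braid_sigma n i) \<otimes>\<^bsub>?G\<^esub> ?inv = ?c"
    using assms by (simp add: m_assoc)
  then have "pbraid_class n (full_twist n) \<otimes>\<^bsub>?G\<^esub> ?inv = ?c"
    using assms by (simp add: pbraid_class_mult pbraid_class_gen flip: cofactor_mult_gen[OF assms])
  with False show ?thesis by simp
qed

theorem full_twist_power_mult_braid_class:
  assumes "braid_wf n w"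
  shows "pbraid_class n (full_twist n ^ neg_count w) \<otimes>\<^bsub>braid_group n\<^esub> braid_class n w
       = pbraid_class n (numerator n w)"
proof -
  interpret group "braid_group n" by (rule group_braid_group)
  let ?G = "braid_group n" and ?Z = "full_twist n"
  show ?thesis
    using assms
  proof (induction w)
    case Nil
    then show ?case by (simp add: pbraid_class_one flip: braid_group_one)
  next
    case (Cons a w)
    define A where "A = numerator n [a]"
    have wf: "braid_wf n [a]" "braid_wf n w"
      using Cons.prems braid_wf_append[of n "[a]" w] by simp_all
    then have A_pos: "A \<in> positive_braids n"
      unfolding A_def by (intro numerator_positive)
    have letter: "pbraid_class n (?Z ^ neg_count [a]) \<otimes>\<^bsub>?G\<^esub> braid_class n [a] = pbraid_class n A"
      using wf(1)
      by (cases a)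
        (simp add: A_def full_twist_power_mult_letter del: neg_count_simps numerator_simps)
    have "?Z ^ neg_count (a # w) = ?Z ^ neg_count w * ?Z ^ neg_count [a]"
      using neg_count_append[of "[a]" w] by (simp add: add.commute flip: power_add)
    moreover have "braid_class n (a # w) = braid_class n [a] \<otimes>\<^bsub>?G\<^esub> braid_class n w"
      using wf by (simp add: braid_class_mult)
    ultimately have "pbraid_class n (?Z ^ neg_count (a # w)) \<otimes>\<^bsub>?G\<^esub> braid_class n (a # w)
        = pbraid_class n (?Z ^ neg_count w)
            \<otimes>\<^bsub>?G\<^esub> (pbraid_class n (?Z ^ neg_count [a]) \<otimes>\<^bsub>?G\<^esub> braid_class n [a])
            \<otimes>\<^bsub>?G\<^esub> braid_class n w"
      using wf by (simp add: pbraid_class_mult m_assoc)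
    also have "\<dots> = pbraid_class n (?Z ^ neg_count w * A) \<otimes>\<^bsub>?G\<^esub> braid_class n w"
      using A_pos by (simp add: letter pbraid_class_mult)
    also have "\<dots> = pbraid_class n A \<otimes>\<^bsub>?G\<^esub> (pbraid_class n (?Z ^ neg_count w) \<otimes>\<^bsub>?G\<^esub> braid_class n w)"
      using A_pos wf by (simp add: full_twist_power_commute pbraid_class_mult m_assoc)
    also have "\<dots> = pbraid_class n (numerator n ([a] @ w))"
      using Cons.IH[OF wf(2)] A_pos wf(2)
      by (simp only: A_def numerator_append pbraid_class_mult numerator_positive)
    finally show ?case by simp
  qed
qed

lemma braid_class_intertwines_iff:
  assumes w: "braid_wf n w" and U: "U \<in> positive_braids n" and V: "V \<in> positive_braids n"
  shows "braid_class n w \<otimes>\<^bsub>braid_group n\<^esub> pbraid_class n U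
       = pbraid_class n V \<otimes>\<^bsub>braid_group n\<^esub> braid_class n w
    \<longleftrightarrow> numerator n w * U = V * numerator n w"
proof -
  interpret group "braid_group n" by (rule group_braid_group)
  let ?G = "braid_group n" and ?x = "braid_class n w"
  let ?Z = "full_twist n ^ neg_count w" and ?X = "numerator n w"
  have ZX: "pbraid_class n ?Z \<otimes>\<^bsub>?G\<^esub> ?x = pbraid_class n ?X" and X: "?X \<in> positive_braids n"
    using w by (rule full_twist_power_mult_braid_class, rule numerator_positive)
  have "pbraid_class n ?Z \<otimes>\<^bsub>?G\<^esub> (?x \<otimes>\<^bsub>?G\<^esub> pbraid_class n U) = pbraid_class n (?X * U)"
    using w U X by (simp add: pbraid_class_mult flip: ZX m_assoc)
  moreover have "pbraid_class n ?Z \<otimes>\<^bsub>?G\<^esub> (pbraid_class n V \<otimes>\<^bsub>?G\<^esub> ?x) = pbraid_class n (?Z * V) \<otimes>\<^bsub>?G\<^esub> ?x"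
    using w V by (simp add: pbraid_class_mult m_assoc)
  moreover have "\<dots> = pbraid_class n (V * ?X)"
    using w V X by (simp add: full_twist_power_commute pbraid_class_mult m_assoc ZX)
  ultimately have "?x \<otimes>\<^bsub>?G\<^esub> pbraid_class n U = pbraid_class n V \<otimes>\<^bsub>?G\<^esub> ?x
      \<longleftrightarrow> pbraid_class n (?X * U) = pbraid_class n (V * ?X)"
    using w U V
    by (metis Units_eq Units_l_cancel braid_class_carrier pbraid_class_carrier full_twist_positive m_closed
        power_positive)
  then show ?thesis
    using U V X by (simp add: inj_on_eq_iff[OF inj_on_pbraid_class])
qed

theorem braid_sigma_power_intertwiner:
  fixes m :: nat
  assumes i: "1 \<le> i" "i < n" and j: "1 \<le> j" "j < n" and m: "m \<ge> 1"
    and x: "x \<in> carrier (braid_group n)"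
    and eq: "x \<otimes>\<^bsub>braid_group n\<^esub> braid_sigma n i [^]\<^bsub>braid_group n\<^esub> m
           = braid_sigma n j [^]\<^bsub>braid_group n\<^esub> m \<otimes>\<^bsub>braid_group n\<^esub> x"
  shows "x \<otimes>\<^bsub>braid_group n\<^esub> braid_sigma n i = braid_sigma n j \<otimes>\<^bsub>braid_group n\<^esub> x"
proof -
  obtain w where w: "braid_wf n w" "x = braid_class n w"
    using x by (rule braid_carrierE)
  have "numerator n w * gen i ^ m = gen j ^ m * numerator n w"
    using eq i j w by (simp add: pbraid_class_power pbraid_class_gen flip: braid_class_intertwines_iff)
  then have "numerator n w * gen i = gen j * numerator n w"
    by (rule gen_power_intertwiner[OF m])
  then show ?thesis
    using i j w by (simp add: pbraid_class_gen flip: braid_class_intertwines_iff)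
qed

lemma (in group) conj_pow:
  assumes "q \<in> carrier G" and "s \<in> carrier G"
  shows "(inv q \<otimes> s \<otimes> q) [^] (m::nat) = inv q \<otimes> s [^] m \<otimes> q"
proof (induction m)
  case 0
  then show ?case using assms by simp
next
  case (Suc m)
  have "inv q \<otimes> s [^] m \<otimes> q \<otimes> (inv q \<otimes> s \<otimes> q) = inv q \<otimes> s [^] m \<otimes> (q \<otimes> inv q) \<otimes> s \<otimes> q"
    using assms by (simp only: m_assoc m_closed inv_closed nat_pow_closed)
  then show ?case using Suc assms by (simp add: m_assoc)
qed

lemma (in group) conj_eq_conj_iff:
  assumes "p \<in> carrier G" and "q \<in> carrier G" and "a \<in> carrier G" and "b \<in> carrier G"
  shows "inv p \<otimes> a \<otimes> p = inv q \<otimes> b \<otimes> q \<longleftrightarrow> (q \<otimes> inv p) \<otimes> a = b \<otimes> (q \<otimes> inv p)"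
proof -
  have "inv p \<otimes> a \<otimes> p = inv q \<otimes> b \<otimes> q \<longleftrightarrow> inv p \<otimes> a \<otimes> p = inv q \<otimes> (b \<otimes> q)"
    using assms by (simp add: m_assoc)
  also have "\<dots> \<longleftrightarrow> b \<otimes> q = (q \<otimes> inv p \<otimes> a) \<otimes> p"
    using assms inv_solve_left[of "inv p \<otimes> a \<otimes> p" q "b \<otimes> q"] by (simp add: m_assoc)
  also have "\<dots> \<longleftrightarrow> q \<otimes> inv p \<otimes> a = b \<otimes> q \<otimes> inv p"
    using assms inv_solve_right[of "q \<otimes> inv p \<otimes> a" "b \<otimes> q" p] by simp
  finally show ?thesis using assms by (simp add: m_assoc)
qed

theorem theorem2p11:
  fixes n m :: nat and H1 H2 :: "bword set"
  assumes "n \<ge> 2" and "m \<ge> 1"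
    and "half_twist n H1" and "half_twist n H2"
    and "H1 [^]\<^bsub>braid_group n\<^esub> m = H2 [^]\<^bsub>braid_group n\<^esub> m"
  shows "H1 = H2"
proof -
  interpret group "braid_group n" by (rule group_braid_group)
  let ?G = "braid_group n" and ?s = "braid_sigma n 1"
  have s: "?s \<in> carrier ?G"
    using assms(1) by simp
  obtain p where p: "p \<in> carrier ?G" and H1: "H1 = inv\<^bsub>?G\<^esub> p \<otimes>\<^bsub>?G\<^esub> ?s \<otimes>\<^bsub>?G\<^esub> p"
    using assms(3) by (auto simp: half_twist_def)
  obtain q where q: "q \<in> carrier ?G" and H2: "H2 = inv\<^bsub>?G\<^esub> q \<otimes>\<^bsub>?G\<^esub> ?s \<otimes>\<^bsub>?G\<^esub> q"
    using assms(4) by (auto simp: half_twist_def)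
  let ?x = "q \<otimes>\<^bsub>?G\<^esub> inv\<^bsub>?G\<^esub> p"
  have "?x \<otimes>\<^bsub>?G\<^esub> ?s [^]\<^bsub>?G\<^esub> m = ?s [^]\<^bsub>?G\<^esub> m \<otimes>\<^bsub>?G\<^esub> ?x"
    using assms(5) p q s by (simp add: H1 H2 conj_pow conj_eq_conj_iff)
  then have "?x \<otimes>\<^bsub>?G\<^esub> ?s = ?s \<otimes>\<^bsub>?G\<^esub> ?x"
    using assms(1,2) p q by (intro braid_sigma_power_intertwiner) auto
  then show ?thesis
    using p q s by (simp add: H1 H2 conj_eq_conj_iff)
qed

end
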